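(* Let $G$ be a clustered graph on $mn$ vertices with clusters $C_i=\{v_{i,1},\dots,v_{i,m}\}$, $i=1,\dots,n$, satisfying: (1) (Commuting condition) for all $i_1,j_1,i_2,j_2\in\{1,\dots,n\}$ and $\alpha,\beta\in\{1,\dots,m\}$, $\left|\mathrm{nbd}_{C_{j_1}}(v_{i_1,\alpha})\cap \mathrm{nbd}_{C_{i_2}}(v_{j_2,\beta})\right| = \left|\mathrm{nbd}_{C_{i_1}}(v_{j_1,\beta})\cap \mathrm{nbd}_{C_{j_2}}(v_{i_2,\alpha})\right|$; (2) (Normality condition) for all $i\neq j$ and $\alpha,\beta$, the number of common neighbours in $C_j$ of $v_{i,\alpha},v_{i,\beta}$ equals the number of common neighbours in $C_i$ of $v_{j,\alpha},v_{j,\beta}$. Construct the clustered graph $H$ on $(2m-1)n$ vertices as follows. Its clusters are $D_i=C_i\cup\widehat{C}_i$, $i=1,\dots,n$, where $\widehat{C}_i=\{v_{i,m},v_{i,m+1},\dots,v_{i,2m-1}\}$ and $v_{i,m+1},\dots,v_{i,2m-1}$ are new vertices (so $C_i\cap\widehat{C}_i=\{v_{i,m}\}$ and $D_i=\{v_{i,1},\dots,v_{i,2m-1}\}$). For all $1\leq i,j\leq n$ and $1\leq l_1,l_2\leq m$, $v_{i,l_1}$ and $v_{j,l_2}$ are adjacent in $H$ iff they are adjacent in $G$. Let $f(v_{i,l})=v_{i,2m-l}$ for $l=1,\dots,m$, $i=1,\dots,n$; for all $i\neq j$ and $1\leq l_1,l_2\leq m$, add an edge between $f(v_{i,l_1})$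 and $f(v_{j,l_2})$ iff $v_{i,l_1}$ and $v_{j,l_2}$ are adjacent in $G$. No other edges are present. Then $H$ and its graph theoretical partial transpose $H^\tau$ (with respect to the clusters $D_1,\dots,D_n$, each ordered as $v_{i,1},\dots,v_{i,2m-1}$) are cospectral.
   Context: All graphs are finite, simple and undirected. A clustered graph with clusters $C_i=\{v_{i,1},\dots,v_{i,m}\}$, $i=1,\dots,n$, has adjacency matrix written as the block matrix $[A_{i,j}]$ with $(A_{i,j})_{\alpha\beta}=1$ iff $v_{i,\alpha}\sim v_{j,\beta}$. $\mathrm{nbd}_{C_j}(v_{i,\alpha})=\{\beta : v_{i,\alpha}\sim v_{j,\beta}\}\subseteq\{1,\dots,m\}$. The graph theoretical partial transpose of a clustered graph with adjacency matrix $[A_{i,j}]$ is the graph on the same vertex set with adjacency matrix $[A_{i,j}^t]$; equivalently, edges inside clusters and edges $(v_{i,k},v_{j,k})$ are kept and each edge $(v_{i,k},v_{j,l})$ with $i\neq j$, $k\neq l$ is replaced by $(v_{i,l},v_{j,k})$. Cospectral means equal multisets of adjacency eigenvalues. *)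

theory Defs
  imports
    "Graph_Theory.Pair_Digraph"
    "Jordan_Normal_Form.Char_Poly"
begin

text \<open>
  The pair \<open>(i, l)\<close> stands for the vertex \<open>v\<^sub>i\<^sub>,\<^sub>l\<close>; both indices start at \<open>1\<close>. Finite simple
  undirected graphs are the \<open>pair_graph\<close>s of the library, in which an edge is represented by its
  two opposite arcs, so that \<open>u\<close> and \<open>v\<close> are adjacent iff \<open>(u, v) \<in> parcs G\<close>.
\<close>

type_synonym cgraph = "(nat \<times> nat) pair_pre_digraph"

definition cluster :: "nat \<Rightarrow> nat \<Rightarrow> (nat \<times> nat) set" where
  "cluster m i = {(i, l) | l. l \<in> {1..m}}"

definition clustered_graph :: "nat \<Rightarrow> nat \<Rightarrow> cgraph \<Rightarrow> bool" where
  "clustered_graph n m G \<longleftrightarrow> pair_graph G \<and> pverts G = (\<Union>i\<in>{1..n}. cluster m i)"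

definition nbd :: "cgraph \<Rightarrow> nat \<Rightarrow> nat \<Rightarrow> nat \<times> nat \<Rightarrow> nat set" where
  "nbd G m j u = {\<beta> \<in> {1..m}. (u, (j, \<beta>)) \<in> parcs G}"

definition common_neighbours ::
    "cgraph \<Rightarrow> (nat \<times> nat) set \<Rightarrow> nat \<times> nat \<Rightarrow> nat \<times> nat \<Rightarrow> (nat \<times> nat) set" where
  "common_neighbours G C u v = {w \<in> C. (u, w) \<in> parcs G \<and> (v, w) \<in> parcs G}"

definition commuting_condition :: "nat \<Rightarrow> nat \<Rightarrow> cgraph \<Rightarrow> bool" where
  "commuting_condition n m G \<longleftrightarrow>
    (\<forall>i1\<in>{1..n}. \<forall>j1\<in>{1..n}. \<forall>i2\<in>{1..n}. \<forall>j2\<in>{1..n}. \<forall>\<alpha>\<in>{1..m}. \<forall>\<beta>\<in>{1..m}.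
      card (nbd G m j1 (i1, \<alpha>) \<inter> nbd G m i2 (j2, \<beta>)) =
      card (nbd G m i1 (j1, \<beta>) \<inter> nbd G m j2 (i2, \<alpha>)))"

definition normality_condition :: "nat \<Rightarrow> nat \<Rightarrow> cgraph \<Rightarrow> bool" where
  "normality_condition n m G \<longleftrightarrow>
    (\<forall>i\<in>{1..n}. \<forall>j\<in>{1..n}. i \<noteq> j \<longrightarrow> (\<forall>\<alpha>\<in>{1..m}. \<forall>\<beta>\<in>{1..m}.
      card (common_neighbours G (cluster m j) (i, \<alpha>) (i, \<beta>)) =
      card (common_neighbours G (cluster m i) (j, \<alpha>) (j, \<beta>))))"

definition mirror :: "nat \<Rightarrow> nat \<times> nat \<Rightarrow> nat \<times> nat" where
  "mirror m v = (fst v, 2 * m - snd v)"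

text \<open>
  Mirrored arcs have both ends at positions in \<open>{m..2 * m - 1}\<close>, so the only ones
  between vertices of \<open>G\<close> join some \<open>(i, m)\<close> and \<open>(j, m)\<close>, which are fixed by \<open>mirror m\<close>; hence
  the doubled graph induces \<open>G\<close> on the vertices of \<open>G\<close>.
\<close>

definition mirror_double :: "nat \<Rightarrow> nat \<Rightarrow> cgraph \<Rightarrow> cgraph" where
  "mirror_double n m G =
    \<lparr> pverts = (\<Union>i\<in>{1..n}. cluster (2 * m - 1) i),
      parcs = parcs G \<union> {(mirror m u, mirror m v) | u v. (u, v) \<in> parcs G \<and> fst u \<noteq> fst v} \<rparr>"

definition partial_transpose :: "cgraph \<Rightarrow> cgraph" where
  "partial_transpose G =
    \<lparr> pverts = pverts G,
      parcs = {((i, k), (j, l)) | i k j l. ((i, l), (j, k)) \<in> parcs G} \<rparr>"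

text \<open>Matrix indices of the library start at \<open>0\<close>, vertex and cluster indices at \<open>1\<close>.\<close>

definition adj_block :: "nat \<Rightarrow> cgraph \<Rightarrow> nat \<Rightarrow> nat \<Rightarrow> complex mat" where
  "adj_block m G i j =
    mat m m (\<lambda>(a, b). if ((i, Suc a), (j, Suc b)) \<in> parcs G then 1 else 0)"

definition adj_matrix :: "nat \<Rightarrow> nat \<Rightarrow> cgraph \<Rightarrow> complex mat" where
  "adj_matrix n m G =
    mat (n * m) (n * m)
      (\<lambda>(p, q). adj_block m G (Suc (p div m)) (Suc (q div m)) $$ (p mod m, q mod m))"

text \<open>The roots are taken over the complex numbers, so all \<open>n * m\<close> eigenvalues are counted.\<close>

definition adj_spectrum :: "nat \<Rightarrow> nat \<Rightarrow> cgraph \<Rightarrow> complex multiset" where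
  "adj_spectrum n m G = proots (char_poly (adj_matrix n m G))"

definition cospectral :: "nat \<Rightarrow> nat \<Rightarrow> cgraph \<Rightarrow> cgraph \<Rightarrow> bool" where
  "cospectral n m G G' \<longleftrightarrow> adj_spectrum n m G = adj_spectrum n m G'"

lemma adj_block_partial_transpose:
  "adj_block m (partial_transpose G) i j = transpose_mat (adj_block m G i j)"
  by (rule eq_matI) (auto simp: adj_block_def partial_transpose_def)

lemma pverts_clustered_graph: "clustered_graph n m G \<Longrightarrow> pverts G = {1..n} \<times> {1..m}"
  by (auto simp: clustered_graph_def cluster_def)

lemma clustered_graphI:
  assumes "pverts G = {1..n} \<times> {1..m}"
    and "\<And>u v. (u, v) \<in> parcs G \<Longrightarrow>
      u \<in> {1..n} \<times> {1..m} \<and> v \<in> {1..n} \<times> {1..m} \<and> u \<noteq> v \<and> (v, u) \<in> parcs G"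
  shows "clustered_graph n m G"
proof -
  have fin: "finite (pverts G)" using assms(1) by simp
  have sub: "parcs G \<subseteq> pverts G \<times> pverts G" using assms by auto
  have "pair_graph G"
  proof unfold_locales
    show "finite (parcs G)" using finite_subset[OF sub] fin by simp
    show "symmetric (with_proj G)" using assms(2) by (auto simp: symmetric_def sym_def)
  qed (use assms fin in \<open>auto simp: prod_eq_iff dest: assms(2)\<close>)
  with assms(1) show ?thesis by (auto simp: clustered_graph_def cluster_def)
qed

lemma clustered_graphD:
  assumes "clustered_graph n m G" and "(u, v) \<in> parcs G"
  shows "u \<in> {1..n} \<times> {1..m} \<and> v \<in> {1..n} \<times> {1..m} \<and> u \<noteq> v \<and> (v, u) \<in> parcs G"
proof -
  interpret pair_graph G using assms(1) by (simp add: clustered_graph_def)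
  have "(v, u) \<in> parcs G" using pair_sym_arcs assms(2) by (auto simp: symmetric_def dest: symD)
  moreover have "u \<noteq> v" using pair_no_loops[OF assms(2)] by simp
  ultimately show ?thesis
    using wellformed'[OF assms(2)] pverts_clustered_graph[OF assms(1)] by simp
qed

lemma clustered_graph_mirror_double:
  assumes "clustered_graph n m G"
  shows "clustered_graph n (2 * m - 1) (mirror_double n m G)"
  by (rule clustered_graphI)
    (auto simp: mirror_double_def cluster_def mirror_def dest: clustered_graphD[OF assms],
     (fastforce dest: clustered_graphD[OF assms])+)

lemma clustered_graph_partial_transpose:
  assumes "clustered_graph n m G"
  shows "clustered_graph n m (partial_transpose G)"
  using pverts_clustered_graph[OF assms]
  by (intro clustered_graphI)
    (auto simp: partial_transpose_def dest: clustered_graphD[OF assms])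

lemma mirror_double_induces:
  assumes "clustered_graph n m G" and "l1 \<in> {1..m}" and "l2 \<in> {1..m}"
  shows "((i, l1), (j, l2)) \<in> parcs (mirror_double n m G) \<longleftrightarrow> ((i, l1), (j, l2)) \<in> parcs G"
proof -
  have "a = m \<and> b = m \<and> l1 = m \<and> l2 = m"
    if "((i, a), (j, b)) \<in> parcs G" "l1 = 2 * m - a" "l2 = 2 * m - b" for a b
    using clustered_graphD[OF assms(1) that(1)] that assms by auto
  then show ?thesis by (fastforce simp: mirror_double_def mirror_def)
qed

end

theory Submission
  imports Defs
begin

text \<open>
  The commuting condition says that all blocks \<open>A\<^sub>i\<^sub>j\<close> of \<open>G\<close> commute, and the set of blocks is closed
  under transposition. There is then a real orthogonal \<open>Q\<close> with \<open>Q A = A\<^sup>T Q\<close> for all blocks \<open>A\<close> that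
  moreover fixes the last basis vector \<open>e\<close>: start with \<open>A e \<mapsto> A\<^sup>T e\<close> on the cyclic space of \<open>e\<close> under
  the generated algebra, which is well defined and isometric since the algebra is commutative, and
  continue on orthogonal complements. Since \<open>Q\<close> fixes \<open>e\<close>, it can be glued along \<open>e\<close> with its mirror
  image to an orthogonal \<open>U\<close> of size \<open>2m - 1\<close>, which intertwines every block of \<open>H\<close> with its
  transpose. Hence the block diagonal matrix with all diagonal blocks \<open>U\<close> conjugates the adjacency
  matrix of \<open>H\<close> to that of its partial transpose.
\<close>

section \<open>Orthogonal intertwiners of commuting matrices and their transposes\<close>

text \<open>The subspace is given only as a closed set, without a basis. The induction runs over a
  bound \<open>k\<close> on the positions where its vectors may be nonzero: the vectors with zero
  coordinate \<open>k\<close> form a subspace covered by the induction hypothesis, and at most one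
  further direction has to be added.\<close>

lemma orthogonal_projection_exists:
  fixes W :: "real vec set"
  assumes W: "W \<subseteq> carrier_vec m" and zero: "0\<^sub>v m \<in> W"
    and add: "\<And>u w. u \<in> W \<Longrightarrow> w \<in> W \<Longrightarrow> u + w \<in> W"
    and smult: "\<And>c w. w \<in> W \<Longrightarrow> c \<cdot>\<^sub>v w \<in> W"
    and v: "v \<in> carrier_vec m"
  shows "\<exists>p\<in>W. \<forall>w\<in>W. (v - p) \<bullet> w = 0"
proof -
  have "\<exists>p\<in>W. \<forall>w\<in>W. (v - p) \<bullet> w = 0"
    if "k \<le> m" and "W \<subseteq> carrier_vec m" and "0\<^sub>v m \<in> W"
      and "\<forall>u\<in>W. \<forall>w\<in>W. u + w \<in> W" and "\<forall>c. \<forall>w\<in>W. c \<cdot>\<^sub>v w \<in> W"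
      and "\<forall>w\<in>W. \<forall>i<m. k \<le> i \<longrightarrow> w $ i = 0" and "v \<in> carrier_vec m"
    for k and W :: "real vec set" and v
    using that
  proof (induction k arbitrary: W v)
    case 0
    then have "w = 0\<^sub>v m" if "w \<in> W" for w
      using that by (intro eq_vecI) auto
    with 0 show ?case by (metis scalar_prod_right_zero minus_carrier_vec zero_carrier_vec)
  next
    case (Suc k)
    define W0 where "W0 = {w \<in> W. w $ k = 0}"
    have k: "k < m" using Suc.prems(1) by simp
    have IH: "\<exists>p\<in>W0. \<forall>w\<in>W0. (x - p) \<bullet> w = 0" if "x \<in> carrier_vec m" for x
    proof (rule Suc.IH)
      show "\<forall>w\<in>W0. \<forall>i<m. k \<le> i \<longrightarrow> w $ i = 0"
        using Suc.prems(6) unfolding W0_def by (metis (mono_tags) mem_Collect_eq Suc_leI le_neq_implies_less)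
      show "\<forall>u\<in>W0. \<forall>w\<in>W0. u + w \<in> W0" "\<forall>c. \<forall>w\<in>W0. c \<cdot>\<^sub>v w \<in> W0"
        using Suc.prems(2,4,5) k by (auto simp: W0_def subset_iff)
    qed (use Suc.prems k that in \<open>auto simp: W0_def\<close>)
    show ?case
    proof (cases "W0 = W")
      case True
      with IH Suc.prems(7) show ?thesis by simp
    next
      case False
      then obtain u where u: "u \<in> W" "u $ k \<noteq> 0" by (auto simp: W0_def)
      have cW: "w \<in> carrier_vec m" if "w \<in> W" for w using that Suc.prems(2) by auto
      obtain pu where pu: "pu \<in> W0" "\<forall>w\<in>W0. (u - pu) \<bullet> w = 0" using IH cW[OF u(1)] by blast
      obtain pv where pv: "pv \<in> W0" "\<forall>w\<in>W0. (v - pv) \<bullet> w = 0" using IH Suc.prems(7) by blast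
      \<comment> \<open>Gram-Schmidt step: \<open>u'\<close> is orthogonal to \<open>W0\<close> and
        still has a nonzero coordinate \<open>k\<close>, so together with \<open>W0\<close> it spans
        \<open>W\<close>.\<close>
      define u' where "u' = u - pu"
      have puW: "pu \<in> W" "pv \<in> W" using pu pv by (auto simp: W0_def)
      note c = cW[OF u(1)] cW[OF puW(1)] cW[OF puW(2)] Suc.prems(7)
      have "u' = u + (-1) \<cdot>\<^sub>v pu" unfolding u'_def using c by (intro eq_vecI) auto
      then have u'W: "u' \<in> W" using Suc.prems(4,5) u(1) puW by auto
      note c = c cW[OF u'W]
      have "u' $ k \<noteq> 0" using u pu c k by (auto simp: u'_def W0_def)
      then have nz: "u' \<bullet> u' \<noteq> 0"
        using c k by (auto simp: scalar_prod_def sum_nonneg_eq_0_iff)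
      define t where "t = (v \<bullet> u') / (u' \<bullet> u')"
      define p where "p = pv + t \<cdot>\<^sub>v u'"
      have "p \<in> W" using puW u'W Suc.prems(4,5) by (auto simp: p_def)
      moreover have "(v - p) \<bullet> w = 0" if w: "w \<in> W" for w
      proof -
        \<comment> \<open>With this factor, subtracting the multiple of \<open>u'\<close> cancels
          coordinate \<open>k\<close>, which splits \<open>w\<close> into a vector of
          \<open>W0\<close> and a multiple of \<open>u'\<close>.\<close>
        define s where "s = w $ k / u' $ k"
        define w0 where "w0 = w + (- s) \<cdot>\<^sub>v u'"
        have w0: "w0 \<in> W0" 
          using w u'W Suc.prems(4,5) \<open>u' $ k \<noteq> 0\<close> c k cW[OF w]
          by (auto simp: W0_def w0_def s_def)
        have cw0: "w0 \<in> carrier_vec m" using w0 cW by (auto simp: W0_def)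
        have w_eq: "w = w0 + s \<cdot>\<^sub>v u'" using c cW[OF w] by (intro eq_vecI) (auto simp: w0_def)
        have 1: "(v - pv) \<bullet> w0 = 0" "u' \<bullet> w0 = 0" "u' \<bullet> pv = 0"
          using pv pu w0 by (auto simp: u'_def)
        have 2: "pv \<bullet> u' = 0" using 1(3) c by (simp add: comm_scalar_prod)
        have "v - p = (v - pv) - t \<cdot>\<^sub>v u'" using c by (intro eq_vecI) (auto simp: p_def)
        then show ?thesis using c cw0 1 2 nz
          by (simp add: w_eq scalar_prod_add_distrib[of _ m] minus_scalar_prod_distrib[of _ m]
            smult_scalar_prod_distrib[of _ m] scalar_prod_smult_distrib[of _ m] t_def)
      qed
      ultimately show ?thesis by blast
    qed
  qed
  from this[of m W v] show ?thesis using assms by auto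
qed

lemma smult_mat_mult_vec:
  assumes "A \<in> carrier_mat nr nc" "v \<in> carrier_vec nc"
  shows "(c \<cdot>\<^sub>m A) *\<^sub>v v = c \<cdot>\<^sub>v (A *\<^sub>v v)"
  using assms by (intro eq_vecI) (auto simp: smult_scalar_prod_distrib[of _ nc])

section \<open>Commutants and double commutants of sets of real matrices\<close>

definition commutant :: "nat \<Rightarrow> real mat set \<Rightarrow> real mat set" where
  "commutant m S = {B \<in> carrier_mat m m. \<forall>A\<in>S. A * B = B * A}"

lemma commutant_carrier: "A \<in> commutant m S \<Longrightarrow> A \<in> carrier_mat m m"
  by (simp add: commutant_def)

lemma commutant_antimono: "S \<subseteq> T \<Longrightarrow> commutant m T \<subseteq> commutant m S"
  by (auto simp: commutant_def)

lemma one_in_commutant: "S \<subseteq> carrier_mat m m \<Longrightarrow> 1\<^sub>m m \<in> commutant m S"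
  by (auto simp: commutant_def subset_iff)

lemma commutant_add:
  assumes "S \<subseteq> carrier_mat m m" "A \<in> commutant m S" "B \<in> commutant m S"
  shows "A + B \<in> commutant m S"
  using assms by (auto simp: commutant_def subset_iff add_mult_distrib_mat[of _ m m] mult_add_distrib_mat[of _ m m])

lemma commutant_smult:
  assumes "S \<subseteq> carrier_mat m m" "A \<in> commutant m S"
  shows "c \<cdot>\<^sub>m A \<in> commutant m S"
proof -
  have "C * (c \<cdot>\<^sub>m A) = (c \<cdot>\<^sub>m A) * C" if "C \<in> S" for C
  proof -
    have "C \<in> carrier_mat m m" "A \<in> carrier_mat m m" "C * A = A * C"
      using assms that by (auto simp: commutant_def)
    then show ?thesis by (simp add: mult_smult_distrib[of _ m m _ m] mult_smult_assoc_mat[of _ m m _ m])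
  qed
  with assms show ?thesis by (auto simp: commutant_def)
qed

lemma commutant_mult:
  assumes "S \<subseteq> carrier_mat m m" "A \<in> commutant m S" "B \<in> commutant m S"
  shows "A * B \<in> commutant m S"
proof -
  have "C * (A * B) = (A * B) * C" if "C \<in> S" for C
  proof -
    have c: "C \<in> carrier_mat m m" "A \<in> carrier_mat m m" "B \<in> carrier_mat m m"
      and AB: "C * A = A * C" "C * B = B * C"
      using assms that by (auto simp: commutant_def)
    have "C * (A * B) = (C * A) * B" using c by simp
    also have "\<dots> = A * (C * B)" using c AB by simp
    also have "\<dots> = (A * B) * C" using c AB by simp
    finally show ?thesis .
  qed
  with assms show ?thesis by (auto simp: commutant_def)
qed

text \<open>Since the transpose of \<open>A\<close> also lies in \<open>S\<close>, it commutes with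
  \<open>B\<close>; transposing this relation shows that \<open>A\<close> commutes with the
  transpose of \<open>B\<close>.\<close>

lemma commutant_transpose:
  assumes "S \<subseteq> carrier_mat m m" "\<And>A. A \<in> S \<Longrightarrow> transpose_mat A \<in> S" "B \<in> commutant m S"
  shows "transpose_mat B \<in> commutant m S"
proof -
  have "A * transpose_mat B = transpose_mat B * A" if "A \<in> S" for A
  proof -
    have c: "A \<in> carrier_mat m m" "B \<in> carrier_mat m m" using assms(1,3) that by (auto simp: commutant_def)
    have "transpose_mat A * B = B * transpose_mat A"
      using assms(2,3) that by (auto simp: commutant_def)
    then have "transpose_mat (transpose_mat A * B) = transpose_mat (B * transpose_mat A)" by simp
    then show ?thesis using c by (simp add: transpose_mult[of _ m m _ m])
  qed
  with assms show ?thesis by (auto simp: commutant_def)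
qed

text \<open>If \<open>S\<close> lies in its commutant, antitonicity puts the double commutant inside
  the commutant, and every element of the former commutes with every element of the latter.\<close>

lemma double_commutant_commute:
  assumes "S \<subseteq> commutant m S" "A \<in> commutant m (commutant m S)" "B \<in> commutant m (commutant m S)"
  shows "A * B = B * A"
proof -
  have "B \<in> commutant m S" using commutant_antimono[OF assms(1)] assms(3) by blast
  then show ?thesis using assms(2) by (auto simp: commutant_def)
qed

section \<open>Partial isometries over a commutative matrix algebra closed under
  transposition\<close>

locale commutative_transpose_algebra =
  fixes m :: nat and R :: "real mat set"
  assumes carrier: "R \<subseteq> carrier_mat m m"
    and one: "1\<^sub>m m \<in> R"
    and add: "A \<in> R \<Longrightarrow> B \<in> R \<Longrightarrow> A + B \<in> R"
    and smult: "A \<in> R \<Longrightarrow> c \<cdot>\<^sub>m A \<in> R"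
    and mult: "A \<in> R \<Longrightarrow> B \<in> R \<Longrightarrow> A * B \<in> R"
    and transpose: "A \<in> R \<Longrightarrow> transpose_mat A \<in> R"
    and commute: "A \<in> R \<Longrightarrow> B \<in> R \<Longrightarrow> A * B = B * A"
begin

lemma R_carrier [simp]: "A \<in> R \<Longrightarrow> A \<in> carrier_mat m m"
  using carrier by blast

lemma R_dim [simp]: "A \<in> R \<Longrightarrow> dim_row A = m" "A \<in> R \<Longrightarrow> dim_col A = m"
  using R_carrier by blast+

lemma R_mult_vec_carrier [simp]: "A \<in> R \<Longrightarrow> v \<in> carrier_vec m \<Longrightarrow> A *\<^sub>v v \<in> carrier_vec m"
  by (rule mult_mat_vec_carrier) auto

lemma R_mult_zero_vec [simp]: "A \<in> R \<Longrightarrow> A *\<^sub>v 0\<^sub>v m = 0\<^sub>v m"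
  by (intro eq_vecI) auto

declare transpose [simp]

text \<open>
  \<open>\<Gamma>\<close> is the graph of a partial isometry intertwining each \<open>A\<close> with its transpose. Domain and range
  agree so that a vector orthogonal to the domain is also orthogonal to the range.
\<close>

definition equivariant_isometry :: "(real vec \<times> real vec) set \<Rightarrow> bool" where
  "equivariant_isometry \<Gamma> \<longleftrightarrow>
    \<Gamma> \<subseteq> carrier_vec m \<times> carrier_vec m \<and> (0\<^sub>v m, 0\<^sub>v m) \<in> \<Gamma> \<and>
    (\<forall>x y x' y'. (x, y) \<in> \<Gamma> \<longrightarrow> (x', y') \<in> \<Gamma> \<longrightarrow> (x + x', y + y') \<in> \<Gamma> \<and> x \<bullet> x' = y \<bullet> y') \<and>
    (\<forall>c x y. (x, y) \<in> \<Gamma> \<longrightarrow> (c \<cdot>\<^sub>v x, c \<cdot>\<^sub>v y) \<in> \<Gamma>) \<and>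
    (\<forall>A\<in>R. \<forall>x y. (x, y) \<in> \<Gamma> \<longrightarrow> (A *\<^sub>v x, transpose_mat A *\<^sub>v y) \<in> \<Gamma>) \<and>
    Domain \<Gamma> = Range \<Gamma>"

lemma transpose_adjoint:
  assumes "A \<in> R" "u \<in> carrier_vec m" "w \<in> carrier_vec m"
  shows "(A *\<^sub>v u) \<bullet> w = u \<bullet> (transpose_mat A *\<^sub>v w)"
  using assms transpose_vec_mult_scalar[of "transpose_mat A" m m w u] by simp

text \<open>With all factors moved to one side, the two products become those of \<open>v\<close>
  with \<open>B^T A v\<close> and with \<open>A B^T v\<close>. They agree because \<open>A\<close>
  commutes with the transpose of \<open>B\<close>, which is again in \<open>R\<close>.\<close>

lemma cyclic_isometric:
  assumes "A \<in> R" "B \<in> R" "v \<in> carrier_vec m"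
  shows "(A *\<^sub>v v) \<bullet> (B *\<^sub>v v) = (transpose_mat A *\<^sub>v v) \<bullet> (transpose_mat B *\<^sub>v v)"
proof -
  have "(transpose_mat A *\<^sub>v v) \<bullet> (transpose_mat B *\<^sub>v v) = v \<bullet> ((A * transpose_mat B) *\<^sub>v v)"
    using assms transpose transpose_adjoint[of "transpose_mat A" v "transpose_mat B *\<^sub>v v"]
    by (simp add: assoc_mult_mat_vec[of _ m m _ m])
  also have "A * transpose_mat B = transpose_mat B * A" using assms transpose commute by blast
  also have "v \<bullet> ((transpose_mat B * A) *\<^sub>v v) = (B *\<^sub>v v) \<bullet> (A *\<^sub>v v)"
    using assms transpose_adjoint[of B v "A *\<^sub>v v"] by (simp add: assoc_mult_mat_vec[of _ m m _ m])
  also have "\<dots> = (A *\<^sub>v v) \<bullet> (B *\<^sub>v v)" using assms by (intro comm_scalar_prod[of _ m]) auto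
  finally show ?thesis by simp
qed

text \<open>
  For \<open>v = a - p\<close> orthogonal to the domain, the cyclic space \<open>R v\<close> is orthogonal to it as well, and
  \<open>A v \<mapsto> A\<^sup>T v\<close> is isometric on it because \<open>R\<close> is commutative.
\<close>

lemma equivariant_isometry_extend:
  assumes \<Gamma>: "equivariant_isometry \<Gamma>" and a: "a \<in> carrier_vec m"
  obtains \<Gamma>' p where "equivariant_isometry \<Gamma>'" "\<Gamma> \<subseteq> \<Gamma>'" "a \<in> Domain \<Gamma>'"
    "p \<in> Domain \<Gamma>" "(a - p, a - p) \<in> \<Gamma>'"
proof -
  define W where "W = Domain \<Gamma>"
  have sub: "x \<in> carrier_vec m" "y \<in> carrier_vec m" "x \<in> W" "y \<in> W" if "(x, y) \<in> \<Gamma>" for x y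
    using \<Gamma> that by (auto simp: equivariant_isometry_def W_def)
  have zero: "(0\<^sub>v m, 0\<^sub>v m) \<in> \<Gamma>"
    using \<Gamma> by (simp add: equivariant_isometry_def)
  have plus: "(x + x', y + y') \<in> \<Gamma>" and iso: "x \<bullet> x' = y \<bullet> y'"
    if "(x, y) \<in> \<Gamma>" "(x', y') \<in> \<Gamma>" for x y x' y'
    using \<Gamma> that unfolding equivariant_isometry_def by blast+
  have scale: "(c \<cdot>\<^sub>v x, c \<cdot>\<^sub>v y) \<in> \<Gamma>"
    and equi: "A \<in> R \<Longrightarrow> (A *\<^sub>v x, transpose_mat A *\<^sub>v y) \<in> \<Gamma>"
    if "(x, y) \<in> \<Gamma>" for x y c A
    using \<Gamma> that unfolding equivariant_isometry_def by blast+
  have W: "W \<subseteq> carrier_vec m" "0\<^sub>v m \<in> W" using \<Gamma> by (auto simp: equivariant_isometry_def W_def)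
  have W_add: "u + w \<in> W" if "u \<in> W" "w \<in> W" for u w using that plus by (fastforce simp: W_def)
  have W_smult: "c \<cdot>\<^sub>v w \<in> W" if "w \<in> W" for c w using that scale by (fastforce simp: W_def)
  have W_mult: "A *\<^sub>v w \<in> W" if "w \<in> W" "A \<in> R" for A w using that equi by (fastforce simp: W_def)
  obtain p where p: "p \<in> W" and orth: "\<forall>w\<in>W. (a - p) \<bullet> w = 0"
    using orthogonal_projection_exists[OF W W_add W_smult a] by blast
  define v where "v = a - p"
  have cp: "p \<in> carrier_vec m" using p W by blast
  have v: "v \<in> carrier_vec m" using a cp by (simp add: v_def)
  \<comment> \<open>The adjoint moves \<open>A\<close> onto \<open>w\<close>, and \<open>W\<close>
    is invariant under the transposes, so orthogonality of \<open>v\<close> to \<open>W\<close>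
    suffices.\<close>
  have orth_v: "(A *\<^sub>v v) \<bullet> w = 0" "w \<bullet> (A *\<^sub>v v) = 0" if "A \<in> R" "w \<in> W" for A w
  proof -
    have w: "w \<in> carrier_vec m" using that W by blast
    show 1: "(A *\<^sub>v v) \<bullet> w = 0"
      using transpose_adjoint[OF that(1) v w] orth W_mult[OF that(2) transpose[OF that(1)]] by (simp add: v_def)
    show "w \<bullet> (A *\<^sub>v v) = 0" using 1 comm_scalar_prod[of "A *\<^sub>v v" m w] that w v by simp
  qed
  \<comment> \<open>As a relation this needs no check that different \<open>A\<close> with the same
    image of \<open>v\<close> give the same second component; that it is single-valued follows only
    later from the isometry property.\<close>
  define \<Gamma>' where "\<Gamma>' = {(x + A *\<^sub>v v, y + transpose_mat A *\<^sub>v v) | x y A. (x, y) \<in> \<Gamma> \<and> A \<in> R}"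
  have memI: "(x + A *\<^sub>v v, y + transpose_mat A *\<^sub>v v) \<in> \<Gamma>'" if "(x, y) \<in> \<Gamma>" "A \<in> R" for x y A
    using that by (auto simp: \<Gamma>'_def)
  have "(0 :: real) \<cdot>\<^sub>m 1\<^sub>m m = 0\<^sub>m m m" by (intro eq_matI) auto
  then have zeroR: "0\<^sub>m m m \<in> R" using smult[OF one, of 0] by simp
  have zero_v: "0\<^sub>m m m *\<^sub>v v = 0\<^sub>v m" using v by (intro eq_vecI) auto
  have "equivariant_isometry \<Gamma>'"
    unfolding equivariant_isometry_def
  proof (intro conjI allI impI ballI)
    show "\<Gamma>' \<subseteq> carrier_vec m \<times> carrier_vec m" using sub v by (auto simp: \<Gamma>'_def)
    show "(0\<^sub>v m, 0\<^sub>v m) \<in> \<Gamma>'" using memI[OF zero zeroR] zero_v by simp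
  next
    fix u w u' w' assume "(u, w) \<in> \<Gamma>'" "(u', w') \<in> \<Gamma>'"
    then obtain x y A x' y' A' where h: "(x, y) \<in> \<Gamma>" "A \<in> R" "(x', y') \<in> \<Gamma>" "A' \<in> R"
      and eq: "u = x + A *\<^sub>v v" "w = y + transpose_mat A *\<^sub>v v"
        "u' = x' + A' *\<^sub>v v" "w' = y' + transpose_mat A' *\<^sub>v v"
      by (auto simp: \<Gamma>'_def)
    note c = sub[OF h(1)] sub[OF h(3)] v h transpose[OF h(2)] transpose[OF h(4)]
    have "u + u' = (x + x') + (A + A') *\<^sub>v v"
      using c by (intro eq_vecI) (auto simp: eq add_mult_distrib_mat_vec[of _ m m])
    moreover have "w + w' = (y + y') + transpose_mat (A + A') *\<^sub>v v"
      using c by (intro eq_vecI) (auto simp: eq transpose_add[of _ m m] add_mult_distrib_mat_vec[of _ m m])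
    ultimately show "(u + u', w + w') \<in> \<Gamma>'"
      using memI[OF plus[OF h(1) h(3)] add[OF h(2) h(4)]] by simp
    \<comment> \<open>Both \<open>x\<close> and \<open>y\<close> lie in \<open>W\<close>, because
      domain and range agree, so the cross terms vanish on either side. What remains is the isometry
      of the old relation and that of the cyclic space.\<close>
    show "u \<bullet> u' = w \<bullet> w'"
      using c iso[OF h(1) h(3)] cyclic_isometric[OF h(2) h(4) v]
      by (simp add: eq scalar_prod_add_distrib[of _ m] add_scalar_prod_distrib[of _ m] orth_v)
  next
    fix k u w assume "(u, w) \<in> \<Gamma>'"
    then obtain x y A where h: "(x, y) \<in> \<Gamma>" "A \<in> R"
      and eq: "u = x + A *\<^sub>v v" "w = y + transpose_mat A *\<^sub>v v" by (auto simp: \<Gamma>'_def)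
    note c = sub[OF h(1)] v h transpose[OF h(2)]
    have "k \<cdot>\<^sub>v u = k \<cdot>\<^sub>v x + (k \<cdot>\<^sub>m A) *\<^sub>v v" 
      using c by (simp add: eq smult_add_distrib_vec[of _ m] smult_mat_mult_vec[of _ m m])
    moreover have "transpose_mat (k \<cdot>\<^sub>m A) = k \<cdot>\<^sub>m transpose_mat A" by (intro eq_matI) auto
    then have "k \<cdot>\<^sub>v w = k \<cdot>\<^sub>v y + transpose_mat (k \<cdot>\<^sub>m A) *\<^sub>v v" 
      using c by (simp add: eq smult_add_distrib_vec[of _ m] smult_mat_mult_vec[of _ m m])
    ultimately show "(k \<cdot>\<^sub>v u, k \<cdot>\<^sub>v w) \<in> \<Gamma>'"
      using memI[OF scale[OF h(1)] smult[OF h(2)]] by metis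
  next
    fix B u w assume B: "B \<in> R" and "(u, w) \<in> \<Gamma>'"
    then obtain x y A where h: "(x, y) \<in> \<Gamma>" "A \<in> R"
      and eq: "u = x + A *\<^sub>v v" "w = y + transpose_mat A *\<^sub>v v" by (auto simp: \<Gamma>'_def)
    note c = sub[OF h(1)] v h B transpose[OF h(2)] transpose[OF B]
    have "B *\<^sub>v u = B *\<^sub>v x + (B * A) *\<^sub>v v" using c 
      by (simp add: eq mult_add_distrib_mat_vec[of _ m m] assoc_mult_mat_vec[of _ m m _ m])
    \<comment> \<open>Transposing reverses products; commutativity of \<open>R\<close> restores the
      order needed here.\<close>
    moreover have "transpose_mat B *\<^sub>v w = transpose_mat B *\<^sub>v y + transpose_mat (B * A) *\<^sub>v v"
      using c by (simp add: commute[OF B h(2)] transpose_mult[of _ m m _ m] eq 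
        mult_add_distrib_mat_vec[of _ m m] assoc_mult_mat_vec[of _ m m _ m])
    ultimately show "(B *\<^sub>v u, transpose_mat B *\<^sub>v w) \<in> \<Gamma>'"
      using memI[OF equi[OF h(1) B] mult[OF B h(2)]] by simp
  next
    have DR: "Domain \<Gamma> = Range \<Gamma>" using \<Gamma> by (simp add: equivariant_isometry_def)
    show "Domain \<Gamma>' = Range \<Gamma>'"
    proof (intro equalityI subsetI)
      fix u assume "u \<in> Domain \<Gamma>'"
      then obtain x y A where h: "(x, y) \<in> \<Gamma>" "A \<in> R" "u = x + A *\<^sub>v v" by (auto simp: \<Gamma>'_def)
      \<comment> \<open>As \<open>x\<close> is also in the range, it has a preimage
        \<open>z\<close>; using the transpose of \<open>A\<close> in place of \<open>A\<close> then
        makes \<open>u\<close> a second component.\<close>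
      obtain z where "(z, x) \<in> \<Gamma>" using h(1) DR by blast
      from memI[OF this transpose[OF h(2)]] h(3) show "u \<in> Range \<Gamma>'" by auto
    next
      fix u assume "u \<in> Range \<Gamma>'"
      then obtain x y A where h: "(x, y) \<in> \<Gamma>" "A \<in> R" "u = y + transpose_mat A *\<^sub>v v" by (auto simp: \<Gamma>'_def)
      obtain z where "(y, z) \<in> \<Gamma>" using h(1) DR by blast
      from memI[OF this transpose[OF h(2)]] h(3) show "u \<in> Domain \<Gamma>'" by auto
    qed
  qed
  moreover have "\<Gamma> \<subseteq> \<Gamma>'"
  proof
    fix z assume "z \<in> \<Gamma>"
    moreover obtain x y where "z = (x, y)" by (cases z)
    ultimately show "z \<in> \<Gamma>'" using memI[of x y "0\<^sub>m m m"] zeroR sub[of x y] zero_v by simp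
  qed
  moreover have "a \<in> Domain \<Gamma>'"
  proof -
    obtain y where "(p, y) \<in> \<Gamma>" using p by (auto simp: W_def)
    from memI[OF this one] have "p + v \<in> Domain \<Gamma>'" using v by auto
    moreover have "p + v = a" using a cp by (intro eq_vecI) (auto simp: v_def)
    ultimately show ?thesis by simp
  qed
  \<comment> \<open>The zero pair and the identity matrix yield this pair: the new cyclic generator
    is fixed.\<close>
  moreover have "(a - p, a - p) \<in> \<Gamma>'" using memI[OF zero one] v by (simp add: v_def)
  ultimately show thesis using that p by (auto simp: W_def)
qed

text \<open>Starting from a relation that fixes \<open>a\<close>, the unit vectors are added to the
  domain one at a time. Once all are present, their images form the columns of
  \<open>Q\<close>.\<close>

lemma orthogonal_transposer_exists:
  assumes a: "a \<in> carrier_vec m"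
  obtains Q where "Q \<in> carrier_mat m m" "transpose_mat Q * Q = 1\<^sub>m m" "Q * transpose_mat Q = 1\<^sub>m m"
    "Q *\<^sub>v a = a" "\<And>A. A \<in> R \<Longrightarrow> Q * A = transpose_mat A * Q"
proof -
  have "\<exists>\<Gamma>. equivariant_isometry \<Gamma> \<and> (a, a) \<in> \<Gamma> \<and> (\<forall>i<k. unit_vec m i \<in> Domain \<Gamma>)" for k
  proof (induction k)
    case 0
    \<comment> \<open>The domain of this relation contains only zero, so the projection
      \<open>p\<close> of \<open>a\<close> is zero and the first extension fixes \<open>a\<close>
      itself.\<close>
    have zero: "equivariant_isometry {(0\<^sub>v m, 0\<^sub>v m)}"
      using transpose by (auto simp: equivariant_isometry_def)
    then obtain \<Gamma> p where "equivariant_isometry \<Gamma>" "p \<in> Domain {(0\<^sub>v m :: real vec, 0\<^sub>v m :: real vec)}"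
      "(a - p, a - p) \<in> \<Gamma>"
      using equivariant_isometry_extend[OF _ a] by metis
    with a show ?case by auto
  next
    case (Suc k)
    then obtain \<Gamma> where \<Gamma>: "equivariant_isometry \<Gamma>" "(a, a) \<in> \<Gamma>" "\<forall>i<k. unit_vec m i \<in> Domain \<Gamma>" by blast
    obtain \<Gamma>' where "equivariant_isometry \<Gamma>'" "\<Gamma> \<subseteq> \<Gamma>'" "unit_vec m k \<in> Domain \<Gamma>'"
      using equivariant_isometry_extend[OF \<Gamma>(1) unit_vec_carrier] by metis
    with \<Gamma> show ?case by (auto simp: less_Suc_eq intro!: exI[of _ \<Gamma>'])
  qed
  then obtain \<Gamma> where \<Gamma>: "equivariant_isometry \<Gamma>" "(a, a) \<in> \<Gamma>" "\<forall>i<m. unit_vec m i \<in> Domain \<Gamma>" by blast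
  then have "\<forall>i. \<exists>y. i < m \<longrightarrow> (unit_vec m i, y) \<in> \<Gamma>" by blast
  then obtain f where f: "\<And>i. i < m \<Longrightarrow> (unit_vec m i, f i) \<in> \<Gamma>" by metis
  have sub: "x \<in> carrier_vec m" "y \<in> carrier_vec m" if "(x, y) \<in> \<Gamma>" for x y
    using \<Gamma> that by (auto simp: equivariant_isometry_def)
  have iso: "x \<bullet> x' = y \<bullet> y'" if "(x, y) \<in> \<Gamma>" "(x', y') \<in> \<Gamma>" for x y x' y'
    using \<Gamma>(1) that unfolding equivariant_isometry_def by blast
  have cf: "f i \<in> carrier_vec m" if "i < m" for i using f sub that by blast
  define Q where "Q = mat_of_cols m (map f [0..<m])"
  have Q: "Q \<in> carrier_mat m m" using mat_of_cols_carrier(1)[of m "map f [0..<m]"] by (simp add: Q_def)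
  have colQ: "col Q i = f i" if "i < m" for i using that cf by (simp add: Q_def)
  have QtQ: "transpose_mat Q * Q = 1\<^sub>m m"
  proof (rule eq_matI)
    fix i j assume "i < dim_row (1\<^sub>m m :: real mat)" "j < dim_col (1\<^sub>m m :: real mat)"
    then show "(transpose_mat Q * Q) $$ (i, j) = (1\<^sub>m m :: real mat) $$ (i, j)"
      using Q colQ iso[OF f[of i] f[of j], symmetric] by auto
  qed (use Q in auto)
  then have QQt: "Q * transpose_mat Q = 1\<^sub>m m"
    using mat_mult_left_right_inverse[of "transpose_mat Q" m Q] Q by auto
  \<comment> \<open>Coordinate \<open>i\<close> of the transpose of \<open>Q\<close> applied to
    \<open>y\<close> is the product of \<open>f i\<close> and \<open>y\<close>, hence by isometry
    that of the unit vector and \<open>x\<close>. So the relation is contained in the graph of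
    \<open>Q\<close>.\<close>
  have graph: "Q *\<^sub>v x = y" if xy: "(x, y) \<in> \<Gamma>" for x y
  proof -
    have "transpose_mat Q *\<^sub>v y = x"
      using Q sub[OF xy] colQ iso[OF f xy, symmetric] by (intro eq_vecI) auto
    then have "Q *\<^sub>v x = (Q * transpose_mat Q) *\<^sub>v y"
      using Q sub[OF xy] by (simp add: assoc_mult_mat_vec[of _ m m _ m])
    then show ?thesis using QQt sub[OF xy] by simp
  qed
  have "Q * A = transpose_mat A * Q" if A: "A \<in> R" for A
  proof (rule mat_col_eqI)
    fix i assume "i < dim_col (transpose_mat A * Q)"
    then have i: "i < m" using Q by simp
    have "(A *\<^sub>v unit_vec m i, transpose_mat A *\<^sub>v f i) \<in> \<Gamma>"
      using \<Gamma>(1) f[OF i] A unfolding equivariant_isometry_def by blast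
    moreover have "A *\<^sub>v unit_vec m i = col A i"
      using A i by (intro eq_vecI) auto
    ultimately have "Q *\<^sub>v col A i = transpose_mat A *\<^sub>v f i" using graph by simp
    moreover have "col (Q * A) i = Q *\<^sub>v col A i" using A Q i by (intro col_mult2[of _ m m _ m]) auto
    moreover have "col (transpose_mat A * Q) i = transpose_mat A *\<^sub>v col Q i" 
      using A R_carrier[OF transpose[OF A]] Q i by (intro col_mult2[of _ m m _ m]) auto
    ultimately show "col (Q * A) i = col (transpose_mat A * Q) i" using colQ[OF i] by simp
  qed (use Q A carrier in auto)
  then show thesis using that Q QtQ QQt graph[OF \<Gamma>(2)] by blast
qed

end

text \<open>The double commutant of \<open>S\<close> stands in for the algebra generated by
  \<open>S\<close>. Its closure properties are those of any commutant, and it inherits commutativity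
  and closure under transposition from \<open>S\<close>.\<close>

lemma orthogonal_transposer_of_commuting:
  fixes S :: "real mat set"
  assumes S: "S \<subseteq> carrier_mat m m"
    and commute: "\<And>A B. A \<in> S \<Longrightarrow> B \<in> S \<Longrightarrow> A * B = B * A"
    and transpose: "\<And>A. A \<in> S \<Longrightarrow> transpose_mat A \<in> S"
    and a: "a \<in> carrier_vec m"
  obtains Q where "Q \<in> carrier_mat m m" "transpose_mat Q * Q = 1\<^sub>m m" "Q * transpose_mat Q = 1\<^sub>m m"
    "Q *\<^sub>v a = a" "\<And>A. A \<in> S \<Longrightarrow> Q * A = transpose_mat A * Q"
proof -
  let ?R = "commutant m (commutant m S)"
  have C: "commutant m S \<subseteq> carrier_mat m m" using commutant_carrier by blast
  have comm_S: "S \<subseteq> commutant m S" unfolding commutant_def using S commute by blast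
  have S_double: "S \<subseteq> ?R"
  proof
    fix A assume A: "A \<in> S"
    then have "B * A = A * B" if "B \<in> commutant m S" for B
      using that unfolding commutant_def by simp
    with A S show "A \<in> ?R" unfolding commutant_def[of m "commutant m S"] by blast
  qed
  note comm = double_commutant_commute[OF comm_S]
  interpret commutative_transpose_algebra m ?R
  proof
    show "?R \<subseteq> carrier_mat m m" using commutant_carrier by blast
    show "transpose_mat A \<in> ?R" if "A \<in> ?R" for A
      by (rule commutant_transpose[OF C commutant_transpose[OF S transpose] that])
    show "1\<^sub>m m \<in> ?R" by (rule one_in_commutant[OF C])
    show "c \<cdot>\<^sub>m A \<in> ?R" if "A \<in> ?R" for c A by (rule commutant_smult[OF C that])
    fix A B assume AB: "A \<in> ?R" "B \<in> ?R"
    show "A + B \<in> ?R" by (rule commutant_add[OF C AB])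
    show "A * B \<in> ?R" by (rule commutant_mult[OF C AB])
    show "A * B = B * A" by (rule comm[OF AB])
  qed
  show thesis
  proof (rule orthogonal_transposer_exists[OF a])
    fix Q assume Q: "Q \<in> carrier_mat m m" "transpose_mat Q * Q = 1\<^sub>m m" "Q * transpose_mat Q = 1\<^sub>m m"
      "Q *\<^sub>v a = a" and QA: "\<And>A. A \<in> ?R \<Longrightarrow> Q * A = transpose_mat A * Q"
    show thesis by (rule that[OF Q QA]) (use S_double in blast)
  qed
qed

section \<open>Block matrices\<close>

text \<open>The index \<open>p\<close> is \<open>k * N + c\<close> with \<open>c < N\<close>, so the
  sum is grouped into \<open>n\<close> consecutive intervals of length \<open>N\<close>.\<close>

lemma sum_div_mod_blocks:
  fixes f :: "nat \<Rightarrow> nat \<Rightarrow> 'a :: comm_monoid_add"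
  shows "(\<Sum>p<n * N. f (p div N) (p mod N)) = (\<Sum>k<n. \<Sum>c<N. f k c)"
proof -
  have "(\<Sum>p\<in>{k * N..<k * N + N}. f (p div N) (p mod N)) = (\<Sum>c<N. f k c)" for k
  proof -
    have "(\<Sum>p\<in>{k * N..<k * N + N}. f (p div N) (p mod N)) = (\<Sum>c\<in>{0..<N}. f ((c + k * N) div N) ((c + k * N) mod N))"
      using sum.shift_bounds_nat_ivl[of "\<lambda>p. f (p div N) (p mod N)" 0 "k * N" N] by (simp add: add.commute)
    also have "\<dots> = (\<Sum>c<N. f k c)" by (intro sum.cong) auto
    finally show ?thesis .
  qed
  then show ?thesis using sum.nat_group[of "\<lambda>p. f (p div N) (p mod N)" N n] by simp
qed

definition block_matrix :: "nat \<Rightarrow> nat \<Rightarrow> (nat \<Rightarrow> nat \<Rightarrow> 'a mat) \<Rightarrow> 'a mat" where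
  "block_matrix n N F = mat (n * N) (n * N) (\<lambda>(p, q). F (p div N) (q div N) $$ (p mod N, q mod N))"

lemma block_index:
  "p < n * N \<Longrightarrow> p div N < n \<and> p mod N < (N :: nat)"
  by (metis less_mult_imp_div_less mod_less_divisor mult_0_right not_gr_zero not_less_zero)

lemma block_matrix_mult_index:
  fixes F G :: "nat \<Rightarrow> nat \<Rightarrow> 'a :: semiring_0 mat"
  assumes F: "\<And>i j. i < n \<Longrightarrow> j < n \<Longrightarrow> F i j \<in> carrier_mat N N"
    and G: "\<And>i j. i < n \<Longrightarrow> j < n \<Longrightarrow> G i j \<in> carrier_mat N N"
    and pq: "p < n * N" "q < n * N"
  shows "(block_matrix n N F * block_matrix n N G) $$ (p, q) =
    (\<Sum>k<n. (F (p div N) k * G k (q div N)) $$ (p mod N, q mod N))"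
proof -
  note b = block_index[OF pq(1)] block_index[OF pq(2)]
  have "(block_matrix n N F * block_matrix n N G) $$ (p, q) =
      (\<Sum>r<n * N. F (p div N) (r div N) $$ (p mod N, r mod N) * G (r div N) (q div N) $$ (r mod N, q mod N))"
    using pq by (auto simp: block_matrix_def scalar_prod_def atLeast0LessThan intro!: sum.cong)
  also have "\<dots> = (\<Sum>k<n. \<Sum>c<N. F (p div N) k $$ (p mod N, c) * G k (q div N) $$ (c, q mod N))"
    by (rule sum_div_mod_blocks[of "\<lambda>k c. F (p div N) k $$ (p mod N, c) * G k (q div N) $$ (c, q mod N)"])
  also have "\<dots> = (\<Sum>k<n. (F (p div N) k * G k (q div N)) $$ (p mod N, q mod N))"
  proof (rule sum.cong[OF refl])
    fix k assume "k \<in> {..<n}"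
    with b have "F (p div N) k \<in> carrier_mat N N" "G k (q div N) \<in> carrier_mat N N" using F G by auto
    with b show "(\<Sum>c<N. F (p div N) k $$ (p mod N, c) * G k (q div N) $$ (c, q mod N)) =
        (F (p div N) k * G k (q div N)) $$ (p mod N, q mod N)"
      by (auto simp: scalar_prod_def atLeast0LessThan intro!: sum.cong)
  qed
  finally show ?thesis .
qed

definition block_diagonal :: "nat \<Rightarrow> nat \<Rightarrow> 'a :: zero mat \<Rightarrow> 'a mat" where
  "block_diagonal n N U = block_matrix n N (\<lambda>i j. if i = j then U else 0\<^sub>m N N)"

lemma block_matrix_carrier [simp]: "block_matrix n N F \<in> carrier_mat (n * N) (n * N)"
  by (simp add: block_matrix_def)

lemma block_diagonal_carrier [simp]: "block_diagonal n N F \<in> carrier_mat (n * N) (n * N)"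
  by (simp add: block_diagonal_def)

lemma block_diagonal_mult:
  fixes F :: "nat \<Rightarrow> nat \<Rightarrow> 'a :: semiring_0 mat"
  assumes U: "U \<in> carrier_mat N N"
    and F: "\<And>i j. i < n \<Longrightarrow> j < n \<Longrightarrow> F i j \<in> carrier_mat N N"
  shows "block_diagonal n N U * block_matrix n N F = block_matrix n N (\<lambda>i j. U * F i j)"
    and "block_matrix n N F * block_diagonal n N U = block_matrix n N (\<lambda>i j. F i j * U)"
proof -
  let ?D = "\<lambda>i j. if i = j then U else 0\<^sub>m N N"
  have D: "?D i j \<in> carrier_mat N N" for i j :: nat using U by simp
  show "block_diagonal n N U * block_matrix n N F = block_matrix n N (\<lambda>i j. U * F i j)"
  proof (rule eq_matI)
    fix p q assume "p < dim_row (block_matrix n N (\<lambda>i j. U * F i j))"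
      "q < dim_col (block_matrix n N (\<lambda>i j. U * F i j))"
    then have pq: "p < n * N" "q < n * N" by (auto simp: block_matrix_def)
    note b = block_index[OF pq(1)] block_index[OF pq(2)]
    have "(block_diagonal n N U * block_matrix n N F) $$ (p, q) =
        (\<Sum>k<n. (?D (p div N) k * F k (q div N)) $$ (p mod N, q mod N))"
      unfolding block_diagonal_def by (rule block_matrix_mult_index[OF D F pq])
    also have "\<dots> = (\<Sum>k<n. if k = p div N then (U * F k (q div N)) $$ (p mod N, q mod N) else 0)"
    proof (rule sum.cong[OF refl])
      fix k assume "k \<in> {..<n}"
      then have "0\<^sub>m N N * F k (q div N) = 0\<^sub>m N N" using F[of k "q div N"] b by simp
      then show "(?D (p div N) k * F k (q div N)) $$ (p mod N, q mod N) =
          (if k = p div N then (U * F k (q div N)) $$ (p mod N, q mod N) else 0)" using b by simp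
    qed
    finally show "(block_diagonal n N U * block_matrix n N F) $$ (p, q) =
        block_matrix n N (\<lambda>i j. U * F i j) $$ (p, q)"
      using b pq by (simp add: block_matrix_def)
  qed (auto simp: block_matrix_def block_diagonal_def)
  show "block_matrix n N F * block_diagonal n N U = block_matrix n N (\<lambda>i j. F i j * U)"
  proof (rule eq_matI)
    fix p q assume "p < dim_row (block_matrix n N (\<lambda>i j. F i j * U))"
      "q < dim_col (block_matrix n N (\<lambda>i j. F i j * U))"
    then have pq: "p < n * N" "q < n * N" by (auto simp: block_matrix_def)
    note b = block_index[OF pq(1)] block_index[OF pq(2)]
    have "(block_matrix n N F * block_diagonal n N U) $$ (p, q) =
        (\<Sum>k<n. (F (p div N) k * ?D k (q div N)) $$ (p mod N, q mod N))"
      unfolding block_diagonal_def by (rule block_matrix_mult_index[OF F D pq])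
    also have "\<dots> = (\<Sum>k<n. if k = q div N then (F (p div N) k * U) $$ (p mod N, q mod N) else 0)"
    proof (rule sum.cong[OF refl])
      fix k assume "k \<in> {..<n}"
      then have "F (p div N) k * 0\<^sub>m N N = 0\<^sub>m N N" using F[of "p div N" k] b by simp
      then show "(F (p div N) k * ?D k (q div N)) $$ (p mod N, q mod N) =
          (if k = q div N then (F (p div N) k * U) $$ (p mod N, q mod N) else 0)" using b by simp
    qed
    finally show "(block_matrix n N F * block_diagonal n N U) $$ (p, q) =
        block_matrix n N (\<lambda>i j. F i j * U) $$ (p, q)"
      using b pq by (simp add: block_matrix_def)
  qed (auto simp: block_matrix_def block_diagonal_def)
qed

lemma block_diagonal_one: "block_diagonal n N (1\<^sub>m N) = (1\<^sub>m (n * N) :: 'a :: semiring_1 mat)"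
proof (rule eq_matI)
  fix p q assume "p < dim_row (1\<^sub>m (n * N) :: 'a mat)" "q < dim_col (1\<^sub>m (n * N) :: 'a mat)"
  then have pq: "p < n * N" "q < n * N" by auto
  have "p = q \<longleftrightarrow> p div N = q div N \<and> p mod N = q mod N" by (metis div_mult_mod_eq)
  then show "block_diagonal n N (1\<^sub>m N) $$ (p, q) = (1\<^sub>m (n * N) :: 'a mat) $$ (p, q)"
    using pq block_index[OF pq(1)] block_index[OF pq(2)] by (auto simp: block_diagonal_def block_matrix_def)
qed (auto simp: block_diagonal_def block_matrix_def)

text \<open>One \<open>U\<close> intertwines all pairs of blocks, so the block diagonal matrix of
  copies of \<open>U\<close> intertwines the whole matrices; copies of \<open>V\<close> give its
  inverse.\<close>

lemma similar_mat_block_matrix: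
  fixes F F' :: "nat \<Rightarrow> nat \<Rightarrow> 'a :: comm_ring_1 mat"
  assumes U: "U \<in> carrier_mat N N" "V \<in> carrier_mat N N" "U * V = 1\<^sub>m N" "V * U = 1\<^sub>m N"
    and F: "\<And>i j. i < n \<Longrightarrow> j < n \<Longrightarrow> F i j \<in> carrier_mat N N"
      "\<And>i j. i < n \<Longrightarrow> j < n \<Longrightarrow> F' i j \<in> carrier_mat N N"
    and intertwine: "\<And>i j. i < n \<Longrightarrow> j < n \<Longrightarrow> U * F i j = F' i j * U"
  shows "similar_mat (block_matrix n N F') (block_matrix n N F)"
proof -
  let ?U = "block_diagonal n N U" and ?V = "block_diagonal n N V"
  let ?M = "block_matrix n N F" and ?M' = "block_matrix n N F'"
  have prod: "block_diagonal n N X * block_diagonal n N Y = block_diagonal n N (X * Y)"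
    if "X \<in> carrier_mat N N" "Y \<in> carrier_mat N N" for X Y :: "'a mat"
  proof -
    have "block_diagonal n N X * block_diagonal n N Y =
        block_matrix n N (\<lambda>i j. X * (if i = j then Y else 0\<^sub>m N N))"
      unfolding block_diagonal_def[of n N Y] using that by (intro block_diagonal_mult) auto
    also have "(\<lambda>i j :: nat. X * (if i = j then Y else 0\<^sub>m N N)) = (\<lambda>i j. if i = j then X * Y else 0\<^sub>m N N)"
      using that by (auto simp: fun_eq_iff)
    finally show ?thesis by (simp add: block_diagonal_def)
  qed
  have UV: "?U * ?V = 1\<^sub>m (n * N)" "?V * ?U = 1\<^sub>m (n * N)"
    using U by (simp_all add: prod block_diagonal_one)
  have "?U * ?M = block_matrix n N (\<lambda>i j. U * F i j)" by (rule block_diagonal_mult[OF U(1) F(1)])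
  also have "\<dots> = block_matrix n N (\<lambda>i j. F' i j * U)"
    unfolding block_matrix_def
    by (rule cong_mat) (auto dest!: block_index simp: intertwine)
  also have "\<dots> = ?M' * ?U" by (rule block_diagonal_mult[OF U(1) F(2), symmetric])
  finally have "?U * ?M * ?V = ?M' * (?U * ?V)"
    by (simp add: assoc_mult_mat[of _ "n * N" "n * N" _ "n * N" _ "n * N"])
  then have "?M' = ?U * ?M * ?V"
    by (simp add: UV right_mult_one_mat[of _ "n * N" "n * N"])
  then have "similar_mat_wit ?M' ?M ?U ?V" by (rule similar_mat_witI[OF UV]) simp_all
  then show ?thesis by (auto simp: similar_mat_def)
qed

section \<open>Gluing two matrices along a coordinate\<close>

text \<open>The second half carries \<open>Y\<close> with rows and columns reversed;
  \<open>2 * m - 2 - a\<close> is the zero-based form of \<open>mirror\<close>. The halves share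
  only the entry \<open>(m - 1, m - 1)\<close>, which is read from \<open>X\<close>.\<close>

definition fold_double :: "nat \<Rightarrow> 'a :: zero mat \<Rightarrow> 'a mat \<Rightarrow> 'a mat" where
  "fold_double m X Y = mat (2 * m - 1) (2 * m - 1) (\<lambda>(a, b).
    if a < m \<and> b < m then X $$ (a, b)
    else if m - 1 \<le> a \<and> m - 1 \<le> b then Y $$ (2 * m - 2 - a, 2 * m - 2 - b) else 0)"

lemma fold_double_carrier [simp]: "fold_double m X Y \<in> carrier_mat (2 * m - 1) (2 * m - 1)"
  by (simp add: fold_double_def)

lemma fold_double_transpose:
  assumes "X \<in> carrier_mat m m" "Y \<in> carrier_mat m m"
  shows "transpose_mat (fold_double m X Y) = fold_double m (transpose_mat X) (transpose_mat Y)"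
  using assms by (intro eq_matI) (auto simp: fold_double_def)

lemma fold_double_one: "fold_double m (1\<^sub>m m) (1\<^sub>m m) = (1\<^sub>m (2 * m - 1) :: 'a :: semiring_1 mat)"
  by (intro eq_matI) (auto simp: fold_double_def)

text \<open>
  The factor \<open>Q\<close> fixes the shared coordinate \<open>m - 1\<close>, so \<open>fold_double m Q Q\<close> acts on the two halves
  independently although they overlap.
\<close>

lemma fold_double_mult:
  fixes Q X Y :: "'a :: semiring_1 mat"
  assumes m: "m \<ge> 1"
    and c: "Q \<in> carrier_mat m m" "X \<in> carrier_mat m m" "Y \<in> carrier_mat m m"
    and row: "\<And>b. b < m \<Longrightarrow> Q $$ (m - 1, b) = of_bool (b = m - 1)"
    and col: "\<And>a. a < m \<Longrightarrow> Q $$ (a, m - 1) = of_bool (a = m - 1)"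
    and corner: "X $$ (m - 1, m - 1) = Y $$ (m - 1, m - 1)"
  shows "fold_double m Q Q * fold_double m X Y = fold_double m (Q * X) (Q * Y)"
proof (rule eq_matI)
  let ?N = "2 * m - 1" and ?U = "fold_double m Q Q" and ?D = "fold_double m X Y"
  fix a b assume "a < dim_row (fold_double m (Q * X) (Q * Y))" "b < dim_col (fold_double m (Q * X) (Q * Y))"
  then have ab: "a < ?N" "b < ?N" by (auto simp: fold_double_def)
  have U: "?U $$ (a, k) = (if a < m \<and> k < m then Q $$ (a, k)
      else if m - 1 \<le> a \<and> m - 1 \<le> k then Q $$ (2 * m - 2 - a, 2 * m - 2 - k) else 0)" if "k < ?N" for k
    using ab that by (simp add: fold_double_def)
  have D: "?D $$ (k, b) = (if k < m \<and> b < m then X $$ (k, b)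
      else if m - 1 \<le> k \<and> m - 1 \<le> b then Y $$ (2 * m - 2 - k, 2 * m - 2 - b) else 0)" if "k < ?N" for k
    using ab that by (simp add: fold_double_def)
  have QX: "(Q * X) $$ (i, j) = (\<Sum>k<m. Q $$ (i, k) * X $$ (k, j))" if "i < m" "j < m" for i j
    using c that by (simp add: scalar_prod_def atLeast0LessThan)
  have QY: "(Q * Y) $$ (i, j) = (\<Sum>k<m. Q $$ (i, k) * Y $$ (k, j))" if "i < m" "j < m" for i j
    using c that by (simp add: scalar_prod_def atLeast0LessThan)
  have eq: "(?U * ?D) $$ (a, b) = (\<Sum>k<?N. ?U $$ (a, k) * ?D $$ (k, b))"
    using ab by (simp add: fold_double_def scalar_prod_def atLeast0LessThan)
  show "(?U * ?D) $$ (a, b) = fold_double m (Q * X) (Q * Y) $$ (a, b)"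
  proof (cases "a < m")
    case True
    have "(\<Sum>k<?N. ?U $$ (a, k) * ?D $$ (k, b)) = (\<Sum>k<m. Q $$ (a, k) * ?D $$ (k, b))"
    proof (rule sum.mono_neutral_cong_right)
      show "\<forall>k\<in>{..<?N} - {..<m}. ?U $$ (a, k) * ?D $$ (k, b) = 0"
      proof
        fix k assume "k \<in> {..<?N} - {..<m}"
        then have k: "k < ?N" "m \<le> k" by auto
        \<comment> \<open>Only the shared row \<open>m - 1\<close> reaches into the second half, and
          there it vanishes because that row of \<open>Q\<close> is a unit vector.\<close>
        have "?U $$ (a, k) = 0"
        proof (cases "a = m - 1")
          case True
          with k have r: "2 * m - 2 - k < m" "2 * m - 2 - k \<noteq> m - 1" "2 * m - 2 - a = m - 1" by auto
          show ?thesis using row[OF r(1)] r k by (simp only: U[OF k(1)]) simp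
        next
          case False
          with k \<open>a < m\<close> show ?thesis by (simp only: U[OF k(1)]) auto
        qed
        then show "?U $$ (a, k) * ?D $$ (k, b) = 0" by simp
      qed
      show "?U $$ (a, k) * ?D $$ (k, b) = Q $$ (a, k) * ?D $$ (k, b)" if "k \<in> {..<m}" for k
        using that True m by (simp add: U)
    qed (use m in auto)
    also have "\<dots> = fold_double m (Q * X) (Q * Y) $$ (a, b)"
    proof (cases "b < m")
      case b: True
      then have "(\<Sum>k<m. Q $$ (a, k) * ?D $$ (k, b)) = (Q * X) $$ (a, b)"
        using True m by (simp add: D QX)
      then show ?thesis using True b ab by (simp add: fold_double_def)
    next
      case b: False
      let ?b = "2 * m - 2 - b"
      \<comment> \<open>Column \<open>b\<close> lies beyond the first half, so it meets the first
        \<open>m\<close> rows only in the shared row \<open>m - 1\<close>, which the reflection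
        fixes.\<close>
      have "(\<Sum>k<m. Q $$ (a, k) * ?D $$ (k, b)) = (\<Sum>k<m. if k = m - 1 then Q $$ (a, k) * Y $$ (k, ?b) else 0)"
        using b m by (intro sum.cong) (auto simp: D mult_2)
      also have "\<dots> = Q $$ (a, m - 1) * Y $$ (m - 1, ?b)" using m by simp
      also have "\<dots> = (if a = m - 1 then (Q * Y) $$ (m - 1, ?b) else 0)"
      proof -
        have "(Q * Y) $$ (m - 1, ?b) = (\<Sum>k<m. if k = m - 1 then Y $$ (k, ?b) else 0)"
          using m b ab by (subst QY, simp, simp, intro sum.cong) (auto simp: row[unfolded One_nat_def])
        also have "\<dots> = Y $$ (m - 1, ?b)" using m by simp
        finally show ?thesis using col[OF True] by simp
      qed
      finally show ?thesis using True b ab m by (auto simp: fold_double_def mult_2)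
    qed
    finally show ?thesis using eq by simp
  next
    case False
    let ?a = "2 * m - 2 - a" and ?r = "\<lambda>k. 2 * m - 2 - k"
    have a: "?a < m - 1" "?a < m" using False ab by auto
    \<comment> \<open>Row \<open>a\<close> lies strictly in the second half, so its entries before
      the shared position vanish; the reflection then turns the sum into one over the indices of
      \<open>Q\<close>.\<close>
    have "(\<Sum>k<?N. ?U $$ (a, k) * ?D $$ (k, b)) = (\<Sum>k\<in>{m - 1..<?N}. Q $$ (?a, ?r k) * ?D $$ (k, b))"
      by (rule sum.mono_neutral_cong_right) (use False m in \<open>auto simp: U\<close>)
    also have "\<dots> = (\<Sum>k<m. Q $$ (?a, k) * ?D $$ (?r k, b))"
    proof (rule sum.reindex_bij_witness[of _ ?r ?r])
      fix k assume "k \<in> {m - 1..<?N}"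
      then have "?r (?r k) = k" "?r k < m" using m by auto
      then show "?r (?r k) = k" "?r k \<in> {..<m}"
        "Q $$ (?a, ?r k) * ?D $$ (?r (?r k), b) = Q $$ (?a, ?r k) * ?D $$ (k, b)" by (simp_all only: lessThan_iff)
    qed (use m in auto)
    also have "\<dots> = fold_double m (Q * X) (Q * Y) $$ (a, b)"
    proof (cases "b < m - 1")
      case True
      \<comment> \<open>The second factor can be nonzero only at the shared position
        \<open>k = m - 1\<close>, where the column condition on \<open>Q\<close> makes the first
        factor zero.\<close>
      have "Q $$ (?a, k) * ?D $$ (?r k, b) = 0" if "k < m" for k
        using that True m a col[of ?a] by (cases "k = m - 1") (auto simp: D)
      then show ?thesis using True False ab by (simp add: fold_double_def)
    next
      case b: False
      let ?b = "2 * m - 2 - b"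
      \<comment> \<open>At the shared entry \<open>fold_double\<close> reads \<open>X\<close>, and
        \<open>corner\<close> makes this equal to the entry of \<open>Y\<close>.\<close>
      have Db: "?D $$ (?r k, b) = Y $$ (k, ?b)" if "k < m" for k
      proof (cases "k = m - 1 \<and> b = m - 1")
        case True
        then have "?r k = m - 1" "?b = m - 1" using m by auto
        then show ?thesis using True m corner D[of "m - 1"] by auto
      next
        case nc: False
        have "m - 1 \<le> ?r k" "?r k < ?N" "\<not> (?r k < m \<and> b < m)" "?r (?r k) = k"
          using that b nc m by auto
        then show ?thesis using b by (auto simp: D)
      qed
      have "(\<Sum>k<m. Q $$ (?a, k) * ?D $$ (?r k, b)) = (Q * Y) $$ (?a, ?b)"
        using a b ab m by (subst QY, simp, simp, intro sum.cong) (simp_all only: Db lessThan_iff)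
      moreover have "fold_double m (Q * X) (Q * Y) $$ (a, b) = (Q * Y) $$ (?a, ?b)"
        using False b ab by (auto simp: fold_double_def)
      ultimately show ?thesis by (simp only:)
    qed
    finally show ?thesis using eq by simp
  qed
qed (auto simp: fold_double_def)

section \<open>Adjacency blocks\<close>

text \<open>A real copy of \<open>adj_block\<close>: the orthogonal projections need a positive
  definite scalar product, whereas the spectrum is taken over the complex numbers.\<close>

definition real_adj_block :: "nat \<Rightarrow> cgraph \<Rightarrow> nat \<Rightarrow> nat \<Rightarrow> real mat" where
  "real_adj_block m G i j =
    mat m m (\<lambda>(a, b). of_bool (((i, Suc a), (j, Suc b)) \<in> parcs G))"

lemma real_adj_block_carrier [simp]: "real_adj_block m G i j \<in> carrier_mat m m"
  by (simp add: real_adj_block_def)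

lemma adj_block_carrier [simp]: "adj_block m G i j \<in> carrier_mat m m"
  by (simp add: adj_block_def)

lemma adj_block_eq_map_mat: "adj_block m G i j = map_mat complex_of_real (real_adj_block m G i j)"
  by (intro eq_matI) (auto simp: adj_block_def real_adj_block_def)

lemma clustered_graph_sym:
  "clustered_graph n m G \<Longrightarrow> (u, v) \<in> parcs G \<longleftrightarrow> (v, u) \<in> parcs G"
  using clustered_graphD by blast

lemma transpose_real_adj_block:
  assumes "clustered_graph n m G"
  shows "transpose_mat (real_adj_block m G i j) = real_adj_block m G j i"
  using clustered_graph_sym[OF assms] by (intro eq_matI) (auto simp: real_adj_block_def)

lemma sum_of_bool_mult_card:
  "(\<Sum>c<m. of_bool (P (Suc c)) * of_bool (Q (Suc c)) :: real) =
    real (card ({\<beta> \<in> {1..m}. P \<beta>} \<inter> {\<beta> \<in> {1..m}. Q \<beta>}))"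
proof -
  have "(\<Sum>c<m. of_bool (P (Suc c)) * of_bool (Q (Suc c)) :: real) =
      (\<Sum>\<beta>\<in>{1..m}. if P \<beta> \<and> Q \<beta> then 1 else 0)"
    by (rule sum.reindex_bij_witness[of _ "\<lambda>\<beta>. \<beta> - 1" Suc]) auto
  also have "\<dots> = real (card ({1..m} \<inter> {\<beta>. P \<beta> \<and> Q \<beta>}))"
    by (simp add: sum.If_cases)
  also have "{1..m} \<inter> {\<beta>. P \<beta> \<and> Q \<beta>} = {\<beta> \<in> {1..m}. P \<beta>} \<inter> {\<beta> \<in> {1..m}. Q \<beta>}" by auto
  finally show ?thesis .
qed

text \<open>By symmetry of the graph, a column of the second factor lists the neighbours of
  \<open>(j2, Suc b)\<close> in cluster \<open>i2\<close>, so the product counts exactly the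
  intersections in the commuting condition.\<close>

lemma real_adj_block_mult_index:
  assumes G: "clustered_graph n m G" and "a < m" "b < m"
  shows "(real_adj_block m G i1 j1 * real_adj_block m G i2 j2) $$ (a, b) =
    real (card (nbd G m j1 (i1, Suc a) \<inter> nbd G m i2 (j2, Suc b)))"
proof -
  have "(real_adj_block m G i1 j1 * real_adj_block m G i2 j2) $$ (a, b) =
      (\<Sum>c<m. of_bool (((i1, Suc a), (j1, Suc c)) \<in> parcs G) * of_bool (((j2, Suc b), (i2, Suc c)) \<in> parcs G))"
    using assms(2,3) clustered_graph_sym[OF G, of "(i2, _)"]
    by (auto simp: real_adj_block_def scalar_prod_def atLeast0LessThan intro!: sum.cong)
  also have "\<dots> = real (card (nbd G m j1 (i1, Suc a) \<inter> nbd G m i2 (j2, Suc b)))"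
    unfolding nbd_def by (rule sum_of_bool_mult_card)
  finally show ?thesis .
qed

lemma real_adj_blocks_commute:
  assumes G: "clustered_graph n m G" and comm: "commuting_condition n m G"
    and "i1 \<in> {1..n}" "j1 \<in> {1..n}" "i2 \<in> {1..n}" "j2 \<in> {1..n}"
  shows "real_adj_block m G i1 j1 * real_adj_block m G i2 j2 =
    real_adj_block m G i2 j2 * real_adj_block m G i1 j1"
proof (rule eq_matI)
  fix a b assume "a < dim_row (real_adj_block m G i2 j2 * real_adj_block m G i1 j1)"
    "b < dim_col (real_adj_block m G i2 j2 * real_adj_block m G i1 j1)"
  then have ab: "a < m" "b < m" by (auto simp: real_adj_block_def)
  then have "Suc a \<in> {1..m}" "Suc b \<in> {1..m}" by auto
  then have "card (nbd G m j1 (i1, Suc a) \<inter> nbd G m i2 (j2, Suc b)) =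
      card (nbd G m i1 (j1, Suc b) \<inter> nbd G m j2 (i2, Suc a))"
    using comm assms(3-6) unfolding commuting_condition_def by blast
  then have "card (nbd G m j1 (i1, Suc a) \<inter> nbd G m i2 (j2, Suc b)) =
      card (nbd G m j2 (i2, Suc a) \<inter> nbd G m i1 (j1, Suc b))"
    by (simp only: Int_commute)
  then show "(real_adj_block m G i1 j1 * real_adj_block m G i2 j2) $$ (a, b) =
      (real_adj_block m G i2 j2 * real_adj_block m G i1 j1) $$ (a, b)"
    by (simp only: real_adj_block_mult_index[OF G ab])
qed (auto simp: real_adj_block_def)

text \<open>The first half is the induced copy of \<open>G\<close>. Outside it only mirrored arcs
  occur, and these join different clusters, so the second half of a diagonal block is zero.\<close>

lemma adj_block_mirror_double:
  assumes m: "m \<ge> 1" and G: "clustered_graph n m G"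
  shows "adj_block (2 * m - 1) (mirror_double n m G) i j =
    fold_double m (adj_block m G i j) (if i = j then 0\<^sub>m m m else adj_block m G i j)"
proof (rule eq_matI)
  let ?H = "mirror_double n m G" and ?F = "fold_double m (adj_block m G i j) (if i = j then 0\<^sub>m m m else adj_block m G i j)"
  fix a b assume "a < dim_row ?F" "b < dim_col ?F"
  then have ab: "a < 2 * m - 1" "b < 2 * m - 1" by (auto simp: fold_double_def)
  show "adj_block (2 * m - 1) ?H i j $$ (a, b) = ?F $$ (a, b)"
  proof (cases "a < m \<and> b < m")
    case True
    then show ?thesis
      using ab mirror_double_induces[OF G, of "Suc a" "Suc b" i j] by (simp add: adj_block_def fold_double_def)
  next
    case False
    let ?a = "2 * m - 2 - a" and ?b = "2 * m - 2 - b"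
    \<comment> \<open>At least one position exceeds \<open>m\<close>, so such an arc is not in
      \<open>G\<close> and must be the mirror image of one; in positions, \<open>mirror\<close>
      exchanges \<open>Suc a\<close> and \<open>Suc ?a\<close>.\<close>
    have "((i, Suc a), (j, Suc b)) \<in> parcs ?H \<longleftrightarrow>
        m - 1 \<le> a \<and> m - 1 \<le> b \<and> i \<noteq> j \<and> ((i, Suc ?a), (j, Suc ?b)) \<in> parcs G"
    proof
      assume "((i, Suc a), (j, Suc b)) \<in> parcs ?H"
      moreover have "((i, Suc a), (j, Suc b)) \<notin> parcs G"
        using clustered_graphD[OF G, of "(i, Suc a)" "(j, Suc b)"] False by auto
      ultimately obtain u v where uv: "(u, v) \<in> parcs G" "fst u \<noteq> fst v"
        "(i, Suc a) = mirror m u" "(j, Suc b) = mirror m v"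
        by (auto simp: mirror_double_def)
      have "snd u \<in> {1..m}" "snd v \<in> {1..m}" using clustered_graphD[OF G uv(1)] by auto
      then have s: "m - 1 \<le> a" "m - 1 \<le> b" "snd u = Suc ?a" "snd v = Suc ?b"
        using uv(3,4) by (auto simp: mirror_def)
      moreover have "fst u = i" "fst v = j" using uv(3,4) by (auto simp: mirror_def)
      ultimately have "u = (i, Suc ?a)" "v = (j, Suc ?b)" by (metis prod.collapse)+
      with uv s show "m - 1 \<le> a \<and> m - 1 \<le> b \<and> i \<noteq> j \<and> ((i, Suc ?a), (j, Suc ?b)) \<in> parcs G" by simp
    next
      assume h: "m - 1 \<le> a \<and> m - 1 \<le> b \<and> i \<noteq> j \<and> ((i, Suc ?a), (j, Suc ?b)) \<in> parcs G"
      have "mirror m (i, Suc ?a) = (i, Suc a)" "mirror m (j, Suc ?b) = (j, Suc b)"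
        using ab by (auto simp: mirror_def)
      with h have "\<exists>u v. ((i, Suc a), (j, Suc b)) = (mirror m u, mirror m v) \<and> (u, v) \<in> parcs G \<and> fst u \<noteq> fst v"
        by (intro exI[of _ "(i, Suc ?a)"] exI[of _ "(j, Suc ?b)"]) simp
      then show "((i, Suc a), (j, Suc b)) \<in> parcs ?H" by (simp add: mirror_double_def)
    qed
    moreover have "?a < m" "?b < m" if "m - 1 \<le> a" "m - 1 \<le> b" using that m by auto
    ultimately show ?thesis using ab False by (auto simp: adj_block_def fold_double_def)
  qed
qed (auto simp: adj_block_def fold_double_def)

lemma adj_matrix_eq_block_matrix:
  "adj_matrix n m G = block_matrix n m (\<lambda>i j. adj_block m G (Suc i) (Suc j))"
  by (simp add: adj_matrix_def block_matrix_def)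

section \<open>Cospectrality of the mirror double and its partial transpose\<close>

theorem theorem9:
  fixes n m :: nat and G :: cgraph
  assumes "m \<ge> 1"
    and "clustered_graph n m G"
    and "commuting_condition n m G"
    and "normality_condition n m G"
  shows "cospectral n (2 * m - 1) (mirror_double n m G)
           (partial_transpose (mirror_double n m G))"
proof -
  note m = assms(1) and G = assms(2)
  let ?H = "mirror_double n m G" and ?N = "2 * m - 1"
  let ?S = "{real_adj_block m G i j | i j. i \<in> {1..n} \<and> j \<in> {1..n}}"
  \<comment> \<open>This coordinate belongs to position \<open>m\<close>, where a cluster and its
    mirror image meet.\<close>
  let ?e = "unit_vec m (m - 1) :: real vec"
  obtain Q where Q: "Q \<in> carrier_mat m m" "transpose_mat Q * Q = 1\<^sub>m m" "Q * transpose_mat Q = 1\<^sub>m m"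
    "Q *\<^sub>v ?e = ?e" and QA: "\<And>A. A \<in> ?S \<Longrightarrow> Q * A = transpose_mat A * Q"
  proof (rule orthogonal_transposer_of_commuting[of ?S m ?e])
    show "A * B = B * A" if "A \<in> ?S" "B \<in> ?S" for A B
      using that real_adj_blocks_commute[OF G assms(3)] by blast
    show "transpose_mat A \<in> ?S" if "A \<in> ?S" for A
      using that transpose_real_adj_block[OF G] by blast
  qed auto
  \<comment> \<open>Orthogonality carries the fixed vector over to the transpose, so both the last
    column and the last row of \<open>Q\<close> are unit vectors, as the gluing requires.\<close>
  have Qte: "transpose_mat Q *\<^sub>v ?e = ?e"
    using arg_cong[OF Q(4), of "\<lambda>v. transpose_mat Q *\<^sub>v v"] Q(1,2)
    by (simp add: assoc_mult_mat_vec[of _ m m _ m, symmetric])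
  have col: "Q $$ (a, m - 1) = of_bool (a = m - 1)" if "a < m" for a
    using arg_cong[OF Q(4), of "\<lambda>v. v $ a"] that Q(1) m by (auto split: if_splits)
  have row: "Q $$ (m - 1, b) = of_bool (b = m - 1)" if "b < m" for b
    using arg_cong[OF Qte, of "\<lambda>v. v $ b"] that Q(1) m by (auto split: if_splits)
  define R where "R = map_mat complex_of_real Q"
  have R: "R \<in> carrier_mat m m" using Q by (simp add: R_def)
  have Rt: "transpose_mat R = map_mat complex_of_real (transpose_mat Q)"
    using Q by (intro eq_matI) (auto simp: R_def)
  have RR: "transpose_mat R * R = 1\<^sub>m m" "R * transpose_mat R = 1\<^sub>m m"
    using Q(1-3) of_real_hom.mat_hom_mult[of "transpose_mat Q" m m Q m, where ?'a = complex]
      of_real_hom.mat_hom_mult[of Q m m "transpose_mat Q" m, where ?'a = complex]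
    unfolding Rt by (simp_all add: R_def of_real_hom.mat_hom_one)
  have R_col: "R $$ (a, m - 1) = of_bool (a = m - 1)" if "a < m" for a
    using col[OF that] that Q(1) m by (simp add: R_def)
  have R_row: "R $$ (m - 1, b) = of_bool (b = m - 1)" if "b < m" for b
    using row[OF that] that Q(1) m by (simp add: R_def)
  note mult_R = fold_double_mult[OF m R _ _ R_row R_col]
  have mult_Rt: "fold_double m (transpose_mat R) (transpose_mat R) * fold_double m X Y =
      fold_double m (transpose_mat R * X) (transpose_mat R * Y)"
    if "X \<in> carrier_mat m m" "Y \<in> carrier_mat m m" "X $$ (m - 1, m - 1) = Y $$ (m - 1, m - 1)" for X Y
    using that R R_col R_row m by (intro fold_double_mult) auto
  let ?U = "fold_double m R R" and ?V = "fold_double m (transpose_mat R) (transpose_mat R)"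
  have tU: "transpose_mat ?U = ?V" by (rule fold_double_transpose[OF R R])
  have UV: "?U * ?V = 1\<^sub>m ?N" "?V * ?U = 1\<^sub>m ?N"
    using R RR m R_col R_row by (simp_all add: mult_R mult_Rt fold_double_one)
  have "?U * adj_block ?N ?H i j = transpose_mat (adj_block ?N ?H i j) * ?U"
    if ij: "i \<in> {1..n}" "j \<in> {1..n}" for i j
  proof -
    let ?X = "adj_block m G i j"
    let ?Y = "if i = j then 0\<^sub>m m m else ?X"
    \<comment> \<open>For distinct clusters the two blocks coincide; in a diagonal block the entry
      is zero because \<open>G\<close> has no loop at \<open>(i, m)\<close>.\<close>
    have corner: "?X $$ (m - 1, m - 1) = ?Y $$ (m - 1, m - 1)"
      using m clustered_graphD[OF G, of "(i, m)" "(i, m)"] by (auto simp: adj_block_def)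
    have Y: "?Y \<in> carrier_mat m m" by simp
    have "real_adj_block m G i j \<in> ?S" using ij by blast
    from QA[OF this] have "map_mat complex_of_real (Q * real_adj_block m G i j) =
        map_mat complex_of_real (transpose_mat (real_adj_block m G i j) * Q)" by simp
    moreover have "transpose_mat ?X = map_mat complex_of_real (transpose_mat (real_adj_block m G i j))"
      by (intro eq_matI) (auto simp: adj_block_eq_map_mat)
    ultimately have X_R: "R * ?X = transpose_mat ?X * R"
      using Q(1) by (simp add: R_def adj_block_eq_map_mat of_real_hom.mat_hom_mult[of _ m m _ m])
    have Y_R: "R * ?Y = transpose_mat ?Y * R"
      using X_R R by (simp add: zero_transpose_mat)
    \<comment> \<open>The product rule for \<open>fold_double\<close> has the orthogonal factor on
      the left, so the product with \<open>?U\<close> on the right is treated through its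
      transpose.\<close>
    have "transpose_mat (transpose_mat (adj_block ?N ?H i j) * ?U) = transpose_mat ?U * adj_block ?N ?H i j"
      by (subst transpose_mult[of _ ?N ?N _ ?N]) (rule fold_double_carrier | simp)+
    also have "\<dots> = ?V * fold_double m ?X ?Y" by (simp only: tU adj_block_mirror_double[OF m G])
    also have "\<dots> = fold_double m (transpose_mat R * ?X) (transpose_mat R * ?Y)"
      by (rule mult_Rt[OF adj_block_carrier Y corner])
    also have "\<dots> = transpose_mat (fold_double m (transpose_mat ?X * R) (transpose_mat ?Y * R))"
    proof -
      have c: "transpose_mat Z * R \<in> carrier_mat m m" "transpose_mat (transpose_mat Z * R) = transpose_mat R * Z"
        if "Z \<in> carrier_mat m m" for Z
        using that R mult_carrier_mat[of "transpose_mat Z" m m R m]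
        by (simp_all add: transpose_mult[of _ m m _ m])
      show ?thesis
        unfolding fold_double_transpose[OF c(1)[OF adj_block_carrier] c(1)[OF Y]]
        by (simp only: c(2)[OF adj_block_carrier] c(2)[OF Y])
    qed
    also have "\<dots> = transpose_mat (fold_double m (R * ?X) (R * ?Y))" by (simp only: X_R Y_R)
    also have "\<dots> = transpose_mat (?U * adj_block ?N ?H i j)"
      unfolding adj_block_mirror_double[OF m G]
      by (subst mult_R[OF adj_block_carrier Y _ _ corner]) auto
    finally show ?thesis by (simp only: transpose_mat_eq)
  qed
  then have "similar_mat (adj_matrix n ?N (partial_transpose ?H)) (adj_matrix n ?N ?H)"
    unfolding adj_matrix_eq_block_matrix
    by (intro similar_mat_block_matrix[OF fold_double_carrier fold_double_carrier UV])
      (auto simp: adj_block_partial_transpose)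
  from char_poly_similar[OF this] show ?thesis by (simp add: cospectral_def adj_spectrum_def)
qed

end
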